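(* Let $\mathcal{A} \in \{0,\ast,?\}^{n\times n}$ and $\mathcal{B} \in \{0,\ast,?\}^{n\times m}$ be pattern matrices. Let $\bar{\mathcal{A}} \in \{0,\ast,?\}^{n\times n}$ be the pattern matrix obtained from $\mathcal{A}$ by modifying only its diagonal entries as follows: $\bar{\mathcal{A}}_{ii} = \ast$ if $\mathcal{A}_{ii} = 0$, and $\bar{\mathcal{A}}_{ii} = \;?$ otherwise (off-diagonal entries are unchanged). Then the structured system $(\mathcal{A},\mathcal{B})$ is controllable (i.e. strongly structurally controllable) if and only if the following two conditions hold: 1. The pattern matrix $\begin{bmatrix}\mathcal{A} & \mathcal{B}\end{bmatrix}$ has full row rank. 2. The pattern matrix $\begin{bmatrix}\bar{\mathcal{A}} & \mathcal{B}\end{bmatrix}$ has full row rank.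
   Context: A pattern matrix is a matrix with entries in the set of symbols $\{0,\ast,?\}$. For a $p\times q$ pattern matrix $\mathcal{M}$, its pattern class is $\mathcal{P}(\mathcal{M}) := \{M\in\mathbb{R}^{p\times q} \mid M_{ij}=0 \text{ if } \mathcal{M}_{ij}=0,\ M_{ij}\neq 0 \text{ if } \mathcal{M}_{ij}=\ast\}$; entries with $\mathcal{M}_{ij}=\;?$ are unrestricted. A pattern matrix $\mathcal{M}$ is said to have full row rank if every $M\in\mathcal{P}(\mathcal{M})$ has full row rank. The structured system $(\mathcal{A},\mathcal{B})$ is the family of linear systems $\dot x(t) = Ax(t)+Bu(t)$ with $A\in\mathcal{P}(\mathcal{A})$, $B\in\mathcal{P}(\mathcal{B})$, state $x\in\mathbb{R}^n$ and input $u\in\mathbb{R}^m$. It is called (strongly structurally) controllable if the pair $(A,B)$ is controllable in the usual sense for all $A\in\mathcal{P}(\mathcal{A})$ and $B\in\mathcal{P}(\mathcal{B})$. *)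

theory Defs
  imports "HOL-Analysis.Analysis"
begin

text \<open>The symbols \<open>0\<close>, \<open>*\<close> (nonzero) and \<open>?\<close> (arbitrary) of a pattern matrix.\<close>

datatype pattern_symbol = PZero | PStar | PAny

definition pattern_class :: "pattern_symbol ^ 'q ^ 'p \<Rightarrow> (real ^ 'q ^ 'p) set"
  where "pattern_class P =
    {M. \<forall>i j. (P $ i $ j = PZero \<longrightarrow> M $ i $ j = 0) \<and>
              (P $ i $ j = PStar \<longrightarrow> M $ i $ j \<noteq> 0)}"

definition pattern_full_row_rank :: "pattern_symbol ^ 'q ^ 'p \<Rightarrow> bool"
  where "pattern_full_row_rank P \<longleftrightarrow> (\<forall>M \<in> pattern_class P. rank M = CARD('p))"

text \<open>The block matrix \<open>[P Q]\<close>: its columns are indexed by the sum of the two column index types.\<close>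

definition hconcat :: "'a ^ 'q ^ 'p \<Rightarrow> 'a ^ 'r ^ 'p \<Rightarrow> 'a ^ ('q + 'r) ^ 'p"
  where "hconcat P Q = (\<chi> i j. case j of Inl k \<Rightarrow> P $ i $ k | Inr k \<Rightarrow> Q $ i $ k)"

definition pattern_bar :: "pattern_symbol ^ 'n ^ 'n \<Rightarrow> pattern_symbol ^ 'n ^ 'n"
  where "pattern_bar P =
    (\<chi> i j. if i = j then (if P $ i $ i = PZero then PStar else PAny) else P $ i $ j)"

text \<open>
  \<open>x\<close> is a solution on \<open>[0, T]\<close> of \<open>x' = A x + B u\<close> for a Lebesgue integrable input \<open>u\<close>.
  As \<open>u\<close> may be discontinuous, the equation is taken in integrated form (Caratheodory
  solutions); this makes \<open>x\<close> continuous, being an indefinite integral.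
\<close>

definition trajectory_on ::
  "real \<Rightarrow> real ^ 'n ^ 'n \<Rightarrow> real ^ 'm ^ 'n \<Rightarrow> (real \<Rightarrow> real ^ 'm) \<Rightarrow> (real \<Rightarrow> real ^ 'n) \<Rightarrow> bool"
  where "trajectory_on T A B u x \<longleftrightarrow>
    u absolutely_integrable_on {0..T} \<and>
    (\<forall>t \<in> {0..T}. ((\<lambda>s. A *v x s + B *v u s) has_integral (x t - x 0)) {0..t})"

definition controllable :: "real ^ 'n ^ 'n \<Rightarrow> real ^ 'm ^ 'n \<Rightarrow> bool"
  where "controllable A B \<longleftrightarrow>
    (\<forall>x0 x1. \<exists>T > 0. \<exists>u x. trajectory_on T A B u x \<and> x 0 = x0 \<and> x T = x1)"

definition strongly_structurally_controllable ::
  "pattern_symbol ^ 'n ^ 'n \<Rightarrow> pattern_symbol ^ 'm ^ 'n \<Rightarrow> bool"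
  where "strongly_structurally_controllable P Q \<longleftrightarrow>
    (\<forall>A \<in> pattern_class P. \<forall>B \<in> pattern_class Q. controllable A B)"

end

theory Submission
  imports Defs "HOL-Computational_Algebra.Polynomial"
begin

text \<open>
  Full row rank of \<open>[A B]\<close> says that no nonzero row vector \<open>x\<close> satisfies \<open>x A = 0\<close> and
  \<open>x B = 0\<close>. Both directions of the theorem are therefore statements about left kernels.

  Suppose first that the system is controllable. A real row vector \<open>p\<close> with \<open>p A = l p\<close> and
  \<open>p B = 0\<close> makes \<open>p \<bullet> x\<close> evolve autonomously, so that a trajectory starting at \<open>0\<close> never
  reaches \<open>p\<close>, unless \<open>p = 0\<close> (\<open>controllable_imp_no_left_eigenvector\<close>). For \<open>l = 0\<close> this is
  the first rank condition. For the second one, let \<open>x\<close> be in the left kernels of \<open>M\<close> and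
  \<open>B\<close>, with \<open>M\<close> in the modified class. Scaling the columns of \<open>M\<close> keeps \<open>x\<close> in the left kernel,
  and a suitable scaling turns \<open>M\<close> plus the identity into a member \<open>A\<close> of the original class;
  then \<open>x A = x\<close>, so that \<open>l = 1\<close> applies (\<open>pattern_bar_kernel_imp_eigenvector\<close>).

  For the converse, suppose that the rank conditions hold, and let \<open>W\<close> be the space of row
  vectors that annihilate every vector \<open>A\<^sup>k B e\<close>; it is mapped into itself by \<open>w \<mapsto> w A\<close> and
  satisfies \<open>w B = 0\<close>. The first rank condition makes \<open>w \<mapsto> w A\<close> injective on \<open>W\<close>, hence onto \<open>W\<close>.
  So a generic \<open>x\<close> in \<open>W\<close> and its image \<open>x A\<close> have the same support, namely all the coordinates
  that do not vanish identically on \<open>W\<close>, and there is an invertible diagonal matrix \<open>D\<close> with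
  \<open>x A = x D\<close>. The matrix \<open>A - D\<close> lies in the modified class and \<open>x (A - D) = 0\<close>, so that
  \<open>x = 0\<close> by the second rank condition. As \<open>x\<close> was generic, \<open>W = 0\<close>
  (\<open>pattern_bar_rank_imp_controllable\<close>). Working with a whole invariant space instead of an
  eigenvector keeps the argument over the reals.

  It remains to turn \<open>W = 0\<close>, which is the Kalman condition, into controls
  (\<open>kalman_imp_controllable\<close>). Instead of inverting a Gramian, one can write down polynomial
  trajectories: if \<open>A\<^sup>N b\<close> with \<open>b = B e\<close> is a combination of lower powers, then any scalar
  polynomial \<open>f\<close> generates a trajectory in the span of these powers
  (\<open>trajectory_krylov_curve\<close>), and prescribing the orders of the zeros of \<open>f\<close> at the two ends of
  the time interval prescribes the two end points of the trajectory up to lower powers.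
\<close>

section \<open>Row rank and left kernels\<close>

lemma full_row_rank_iff_left_kernel:
  fixes M :: "real ^ 'q ^ 'p"
  shows "rank M = CARD('p) \<longleftrightarrow> (\<forall>x. x v* M = 0 \<longrightarrow> x = 0)"
proof -
  have "rank M = CARD('p) \<longleftrightarrow> inj ((*v) (transpose M))"
    using full_rank_injective[of "transpose M"] by (simp add: rank_transpose)
  also have "\<dots> \<longleftrightarrow> (\<forall>x. transpose M *v x = 0 \<longrightarrow> x = 0)"
    by (simp add: linear_injective_0)
  finally show ?thesis by simp
qed

lemma vector_mult_hconcat_eq_0_iff:
  fixes A :: "real ^ 'q ^ 'p" and B :: "real ^ 'r ^ 'p"
  shows "x v* hconcat A B = 0 \<longleftrightarrow> x v* A = 0 \<and> x v* B = 0"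
proof -
  have "x v* hconcat A B = 0 \<longleftrightarrow>
    (\<forall>j. (x v* hconcat A B) $ Inl j = 0) \<and> (\<forall>j. (x v* hconcat A B) $ Inr j = 0)"
    by (auto simp: vec_eq_iff split_sum_all)
  then show ?thesis
    by (simp add: vec_eq_iff vector_matrix_mult_def hconcat_def)
qed

lemma pattern_class_hconcat:
  "pattern_class (hconcat P Q) = {hconcat A B | A B. A \<in> pattern_class P \<and> B \<in> pattern_class Q}"
proof (intro equalityI subsetI)
  fix M assume M: "M \<in> pattern_class (hconcat P Q)"
  define A B where "A = (\<chi> i j. M $ i $ Inl j)" and "B = (\<chi> i j. M $ i $ Inr j)"
  have "M = hconcat A B"
    by (simp add: vec_eq_iff hconcat_def A_def B_def split: sum.split)
  moreover have "A \<in> pattern_class P" "B \<in> pattern_class Q"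
    using M by (auto simp: pattern_class_def hconcat_def A_def B_def split_sum_all)
  ultimately show "M \<in> {hconcat A B | A B. A \<in> pattern_class P \<and> B \<in> pattern_class Q}"
    by blast
next
  fix M assume "M \<in> {hconcat A B | A B. A \<in> pattern_class P \<and> B \<in> pattern_class Q}"
  then show "M \<in> pattern_class (hconcat P Q)"
    by (auto simp: pattern_class_def hconcat_def split_sum_all)
qed

lemma pattern_full_row_rank_hconcat_iff:
  "pattern_full_row_rank (hconcat P Q) \<longleftrightarrow>
    (\<forall>A \<in> pattern_class P. \<forall>B \<in> pattern_class Q. \<forall>x. x v* A = 0 \<longrightarrow> x v* B = 0 \<longrightarrow> x = 0)"
proof -
  have "(\<forall>M \<in> {hconcat A B | A B. A \<in> pattern_class P \<and> B \<in> pattern_class Q}. R M) \<longleftrightarrow>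
      (\<forall>A \<in> pattern_class P. \<forall>B \<in> pattern_class Q. R (hconcat A B))" for R
    by blast
  then show ?thesis
    unfolding pattern_full_row_rank_def pattern_class_hconcat full_row_rank_iff_left_kernel
    by (simp only: vector_mult_hconcat_eq_0_iff) blast
qed

section \<open>Left eigenvectors obstruct controllability\<close>

text \<open>
  The scalar \<open>\<phi> t = p \<bullet> x t\<close> solves \<open>\<phi>' = l \<phi>\<close> with \<open>\<phi> 0 = 0\<close>. The equation is first known
  in integrated form only; this makes \<open>\<phi>\<close> continuous, hence differentiable, and then
  \<open>exp (- l t) \<phi> t\<close> is constant.
\<close>
lemma trajectory_left_eigenvector_zero:
  fixes A :: "real ^ 'n ^ 'n" and B :: "real ^ 'm ^ 'n"
  assumes tr: "trajectory_on T A B u x" and T: "0 < T" and x0: "x 0 = 0"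
    and pA: "p v* A = l *\<^sub>R p" and pB: "p v* B = 0"
  shows "p \<bullet> x T = 0"
proof -
  define \<phi> where "\<phi> t = p \<bullet> x t" for t
  have eq: "p \<bullet> (A *v y + B *v z) = l * (p \<bullet> y)" for y z
    by (simp add: inner_add_right pA pB flip: dot_lmul_matrix)
  have int: "((\<lambda>s. l * \<phi> s) has_integral \<phi> t) {0..t}" if "t \<in> {0..T}" for t
  proof -
    have "((\<lambda>s. A *v x s + B *v u s) has_integral x t) {0..t}"
      using tr that x0 by (force simp: trajectory_on_def)
    from has_integral_linear[OF this bounded_linear_inner_right[of p]] show ?thesis
      by (simp add: o_def eq \<phi>_def)
  qed
  have \<phi>_eq: "\<phi> t = integral {0..t} (\<lambda>s. l * \<phi> s)" if "t \<in> {0..T}" for t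
    by (rule integral_unique[OF int[OF that], symmetric])
  have "continuous_on {0..T} (\<lambda>t. integral {0..t} (\<lambda>s. l * \<phi> s))"
    using int[of T] T by (intro indefinite_integral_continuous_1) auto
  then have cont: "continuous_on {0..T} \<phi>"
    by (rule continuous_on_eq) (simp add: \<phi>_eq)
  have deriv: "(\<phi> has_real_derivative l * \<phi> t) (at t within {0..T})" if "t \<in> {0..T}" for t
  proof -
    have "((\<lambda>t. integral {0..t} (\<lambda>s. l * \<phi> s)) has_vector_derivative l * \<phi> t) (at t within {0..T})"
      using that by (intro integral_has_vector_derivative continuous_intros cont) auto
    then have "(\<phi> has_vector_derivative l * \<phi> t) (at t within {0..T})"
      by (rule has_vector_derivative_transform[OF that, rotated]) (rule \<phi>_eq)
    then show ?thesis
      by (simp add: has_real_derivative_iff_has_vector_derivative)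
  qed
  have "\<exists>c. \<forall>t\<in>{0..T}. exp (- l * t) * \<phi> t = c"
  proof (rule has_field_derivative_zero_constant)
    fix t assume t: "t \<in> {0..T}"
    show "((\<lambda>t. exp (- l * t) * \<phi> t) has_real_derivative 0) (at t within {0..T})"
      by (rule derivative_eq_intros deriv[OF t] refl | simp)+
  qed auto
  then have "exp (- l * T) * \<phi> T = exp (- l * 0) * \<phi> 0"
    using T by (metis atLeastAtMost_iff less_eq_real_def order_refl)
  moreover have "\<phi> 0 = 0" by (simp add: \<phi>_def x0)
  ultimately show ?thesis by (simp add: \<phi>_def)
qed

lemma controllable_imp_no_left_eigenvector:
  fixes A :: "real ^ 'n ^ 'n" and B :: "real ^ 'm ^ 'n"
  assumes "controllable A B" and "p v* A = l *\<^sub>R p" and "p v* B = 0"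
  shows "p = 0"
proof -
  obtain T u x where "T > 0" "trajectory_on T A B u x" "x 0 = 0" "x T = p"
    using assms(1) unfolding controllable_def by blast
  then have "p \<bullet> p = 0"
    using trajectory_left_eigenvector_zero assms by metis
  then show ?thesis by simp
qed

section \<open>Controllability from the Kalman condition\<close>

text \<open>
  Pairs of initial and final states over the fixed time interval \<open>[0, 1]\<close>. Recording both end
  points makes this a linear subspace, so that it suffices to find trajectories for a spanning set
  of initial states (ending at \<open>0\<close>) and of final states (starting at \<open>0\<close>).
\<close>
definition reaches :: "real ^ 'n ^ 'n \<Rightarrow> real ^ 'm ^ 'n \<Rightarrow> ((real ^ 'n) \<times> (real ^ 'n)) set"
  where "reaches A B = {(x 0, x 1) | u x. trajectory_on 1 A B u x}"

lemma trajectory_on_add: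
  assumes "trajectory_on T A B u x" "trajectory_on T A B v y"
  shows "trajectory_on T A B (\<lambda>t. u t + v t) (\<lambda>t. x t + y t)"
proof -
  have "((\<lambda>s. A *v (x s + y s) + B *v (u s + v s)) has_integral (x t + y t - (x 0 + y 0))) {0..t}"
    if "t \<in> {0..T}" for t
  proof -
    have "((\<lambda>s. (A *v x s + B *v u s) + (A *v y s + B *v v s)) has_integral
        ((x t - x 0) + (y t - y 0))) {0..t}"
      using assms that unfolding trajectory_on_def by (intro has_integral_add) auto
    then show ?thesis by (simp add: matrix_vector_right_distrib algebra_simps)
  qed
  then show ?thesis
    using assms by (auto simp: trajectory_on_def)
qed

lemma trajectory_on_scaleR:
  assumes "trajectory_on T A B u x"
  shows "trajectory_on T A B (\<lambda>t. c *\<^sub>R u t) (\<lambda>t. c *\<^sub>R x t)"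
proof -
  have "((\<lambda>s. A *v (c *\<^sub>R x s) + B *v (c *\<^sub>R u s)) has_integral (c *\<^sub>R x t - c *\<^sub>R x 0)) {0..t}"
    if "t \<in> {0..T}" for t
  proof -
    have "((\<lambda>s. c *\<^sub>R (A *v x s + B *v u s)) has_integral (c *\<^sub>R (x t - x 0))) {0..t}"
      using assms that unfolding trajectory_on_def by (intro has_integral_cmul) auto
    then show ?thesis by (simp add: matrix_vector_mult_scaleR algebra_simps)
  qed
  then show ?thesis
    using assms by (auto simp: trajectory_on_def)
qed

lemma subspace_reaches: "subspace (reaches A B)"
proof (rule subspaceI)
  have "trajectory_on 1 A B (\<lambda>t. 0) (\<lambda>t. 0)"
    by (simp add: trajectory_on_def)
  then show "0 \<in> reaches A B"
    by (force simp: reaches_def zero_prod_def)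
next
  fix p q assume "p \<in> reaches A B" "q \<in> reaches A B"
  then show "p + q \<in> reaches A B"
    unfolding reaches_def by (force dest: trajectory_on_add)
next
  fix c p assume "p \<in> reaches A B"
  then show "c *\<^sub>R p \<in> reaches A B"
    unfolding reaches_def by (force dest: trajectory_on_scaleR[where c = c])
qed

lemma trajectory_onI_has_vector_derivative:
  fixes A :: "real ^ 'n ^ 'n" and B :: "real ^ 'm ^ 'n"
  assumes "continuous_on {0..T} u"
    and d: "\<And>t. (x has_vector_derivative (A *v x t + B *v u t)) (at t)"
  shows "trajectory_on T A B u x"
proof -
  have "u absolutely_integrable_on {0..T}"
    using assms(1) by (simp add: absolutely_integrable_continuous_real)
  moreover have "((\<lambda>s. A *v x s + B *v u s) has_integral (x t - x 0)) {0..t}" if "t \<in> {0..T}" for t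
    using that by (intro fundamental_theorem_of_calculus has_vector_derivative_at_within[OF d]) auto
  ultimately show ?thesis
    by (simp add: trajectory_on_def)
qed

text \<open>
  If \<open>A\<^sup>N b = (\<Sum>i<N. a i *\<^sub>R A\<^sup>N\<^sup>-\<^sup>1\<^sup>-\<^sup>i b)\<close>, these are the coefficients that the curve
  \<open>(\<Sum>i<N. w i t *\<^sub>R A\<^sup>N\<^sup>-\<^sup>1\<^sup>-\<^sup>i b)\<close> must have for \<open>x' - A x\<close> to be a multiple of \<open>b\<close>:
  comparing coefficients of the powers gives \<open>w (i + 1) = w i' - a i f\<close> with \<open>f = w 0\<close>, and the
  multiple of \<open>b\<close> that remains is \<open>w N\<close>.
\<close>
primrec krylov_coeff :: "real poly \<Rightarrow> (nat \<Rightarrow> real) \<Rightarrow> nat \<Rightarrow> real poly"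
  where
    "krylov_coeff f a 0 = f"
  | "krylov_coeff f a (Suc i) = pderiv (krylov_coeff f a i) - smult (a i) f"

text \<open>
  Each step of the recursion differentiates and adds a multiple of \<open>f\<close>, whose zero at \<open>c\<close> has at
  least the order of the zeros before it; so the order of the zero drops by exactly one. In
  particular the coefficients with index below \<open>j\<close> vanish at \<open>c\<close>, and the one with index \<open>j\<close> is
  the first that does not.
\<close>
lemma krylov_coeff_root:
  fixes c :: real
  assumes f: "f = [:-c, 1:] ^ j * h" and "poly h c \<noteq> 0" and "i \<le> j"
  shows "\<exists>g. krylov_coeff f a i = [:-c, 1:] ^ (j - i) * g \<and> poly g c \<noteq> 0"
  using \<open>i \<le> j\<close>
proof (induction i)
  case 0
  then show ?case using assms by auto
next
  case (Suc i)
  then obtain g where g: "krylov_coeff f a i = [:-c, 1:] ^ (j - i) * g" "poly g c \<noteq> 0" by auto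
  define m where "m = j - Suc i"
  have m: "j - i = Suc m" "j = m + Suc i" using Suc.prems by (auto simp: m_def)
  define g' where "g' = smult (real (Suc m)) g + [:-c, 1:] * pderiv g - smult (a i) ([:-c, 1:] ^ Suc i * h)"
  have "krylov_coeff f a (Suc i) = pderiv ([:-c, 1:] ^ Suc m * g) - smult (a i) ([:-c, 1:] ^ (m + Suc i) * h)"
    using g(1) f m by simp
  also have "pderiv ([:-c, 1:] ^ Suc m * g) =
     [:-c, 1:] ^ m * (smult (real (Suc m)) g + [:-c, 1:] * pderiv g)"
  proof -
    have "pderiv ([:-c, 1:] ^ Suc m) = smult (real (Suc m)) ([:-c, 1:] ^ m)"
      by (simp add: pderiv_power_Suc pderiv_pCons del: power_Suc mult_pCons_right flip: one_pCons)
    then show ?thesis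
      by (simp add: pderiv_mult algebra_simps
          del: mult_pCons_left mult_pCons_right power_Suc of_nat_Suc) (simp add: algebra_simps)
  qed
  also have "\<dots> - smult (a i) ([:-c, 1:] ^ (m + Suc i) * h) = [:-c, 1:] ^ m * g'"
    by (simp add: g'_def power_add algebra_simps del: mult_pCons_left mult_pCons_right)
  finally have "krylov_coeff f a (Suc i) = [:-c, 1:] ^ (j - Suc i) * g'"
    by (simp add: m_def)
  moreover have "poly g' c \<noteq> 0"
    using g(2) by (simp add: g'_def)
  ultimately show ?case by blast
qed

abbreviation krylov :: "real ^ 'n ^ 'n \<Rightarrow> nat \<Rightarrow> real ^ 'n \<Rightarrow> real ^ 'n"
  where "krylov A k b \<equiv> (((*v) A) ^^ k) b"

definition krylov_curve ::
  "real ^ 'n ^ 'n \<Rightarrow> real ^ 'n \<Rightarrow> nat \<Rightarrow> real poly \<Rightarrow> (nat \<Rightarrow> real) \<Rightarrow> real \<Rightarrow> real ^ 'n"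
  where "krylov_curve A b N f a t = (\<Sum>i<N. poly (krylov_coeff f a i) t *\<^sub>R krylov A (N - Suc i) b)"

text \<open>
  Differentiating the coefficients shifts their index and produces \<open>f\<close> times the combination of
  powers that equals \<open>A\<^sup>N b\<close>; this is the top term of \<open>A x\<close>. The term with index \<open>N\<close> that
  the shift leaves over is the contribution of the input.
\<close>
lemma trajectory_krylov_curve:
  fixes A :: "real ^ 'n ^ 'n" and B :: "real ^ 'm ^ 'n"
  assumes rel: "krylov A N b = (\<Sum>i<N. a i *\<^sub>R krylov A (N - Suc i) b)" and b: "b = B *v e"
  shows "trajectory_on T A B (\<lambda>t. poly (krylov_coeff f a N) t *\<^sub>R e) (krylov_curve A b N f a)"
proof (rule trajectory_onI_has_vector_derivative)
  show "continuous_on {0..T} (\<lambda>t. poly (krylov_coeff f a N) t *\<^sub>R e)"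
    by (intro continuous_intros)
next
  fix t
  let ?w = "\<lambda>i. poly (krylov_coeff f a i) t" and ?k = "\<lambda>i. krylov A (N - i) b"
  have "(krylov_curve A b N f a has_vector_derivative
      (\<Sum>i<N. poly (pderiv (krylov_coeff f a i)) t *\<^sub>R ?k (Suc i))) (at t)"
    unfolding krylov_curve_def[abs_def]
    by (auto intro!: derivative_eq_intros poly_DERIV)
  also have "(\<Sum>i<N. poly (pderiv (krylov_coeff f a i)) t *\<^sub>R ?k (Suc i)) =
      (\<Sum>i<N. ?w (Suc i) *\<^sub>R ?k (Suc i)) + ?w 0 *\<^sub>R (\<Sum>i<N. a i *\<^sub>R ?k (Suc i))"
    by (simp add: sum.distrib[symmetric] scaleR_sum_right algebra_simps)
  also have "\<dots> = ?w 0 *\<^sub>R ?k 0 + (\<Sum>i<N. ?w (Suc i) *\<^sub>R ?k (Suc i))"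
    using rel by simp
  also have "\<dots> = (\<Sum>i<Suc N. ?w i *\<^sub>R ?k i)"
    by (subst sum.lessThan_Suc_shift) simp
  also have "\<dots> = (\<Sum>i<N. ?w i *\<^sub>R ?k i) + ?w N *\<^sub>R b"
    by simp
  also have "(\<Sum>i<N. ?w i *\<^sub>R ?k i) = A *v krylov_curve A b N f a t"
  proof -
    have "?k i = A *v ?k (Suc i)" if "i < N" for i
    proof -
      have "N - i = Suc (N - Suc i)" using that by simp
      then show ?thesis by simp
    qed
    then show ?thesis
      by (simp add: krylov_curve_def linear_sum[OF matrix_vector_mul_linear]
          matrix_vector_mult_scaleR)
  qed
  finally show "(krylov_curve A b N f a has_vector_derivative
      A *v krylov_curve A b N f a t + B *v (?w N *\<^sub>R e)) (at t)"
    by (simp add: b matrix_vector_mult_scaleR)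
qed

lemma span_image_lessThan:
  fixes v :: "nat \<Rightarrow> 'a::real_vector"
  assumes "x \<in> span (v ` {..<N})"
  shows "\<exists>a. x = (\<Sum>i<N. a i *\<^sub>R v i)"
proof -
  define g where "g a = (\<Sum>i<N. a i *\<^sub>R v i)" for a
  have "subspace (range g)"
  proof (rule subspaceI)
    have "g (\<lambda>_. 0) = 0" by (simp add: g_def)
    then show "0 \<in> range g" by (metis rangeI)
  next
    fix x y assume "x \<in> range g" "y \<in> range g"
    then obtain a b where "x = g a" "y = g b" by blast
    then have "x + y = g (\<lambda>i. a i + b i)"
      by (simp add: g_def scaleR_left_distrib sum.distrib)
    then show "x + y \<in> range g" by (simp only: rangeI)
  next
    fix c x assume "x \<in> range g"
    then obtain a where "x = g a" by blast
    then have "c *\<^sub>R x = g (\<lambda>i. c * a i)"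
      by (simp add: g_def scaleR_sum_right)
    then show "c *\<^sub>R x \<in> range g" by (simp only: rangeI)
  qed
  moreover have "v ` {..<N} \<subseteq> range g"
  proof clarify
    fix k assume "k < N"
    then have "v k = g (\<lambda>i. if i = k then 1 else 0)"
      by (simp add: g_def if_distrib[of "\<lambda>c. c *\<^sub>R _"] cong: if_cong)
    then show "v k \<in> range g" by (simp only: rangeI)
  qed
  ultimately have "x \<in> range g"
    using assms span_minimal by blast
  then show ?thesis by (auto simp: g_def)
qed

text \<open>
  The spans of the first \<open>N\<close> vectors cannot grow in dimension forever, and once one of them absorbs
  the next vector it is invariant under \<open>A\<close>.
\<close>
lemma krylov_stabilizes:
  fixes A :: "real ^ 'n ^ 'n"
  shows "\<exists>N. \<forall>k. krylov A k b \<in> span ((\<lambda>i. krylov A i b) ` {..<N})"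
proof -
  let ?S = "\<lambda>N. span ((\<lambda>i. krylov A i b) ` {..<N})"
  have "\<exists>N. krylov A N b \<in> ?S N"
  proof (rule ccontr)
    assume "\<nexists>N. krylov A N b \<in> ?S N"
    then have "dim (?S N) = N" for N
      by (induction N) (simp_all add: lessThan_Suc dim_insert)
    then show False
      using dim_subset_UNIV[of "?S (Suc DIM(real ^ 'n))"] by simp
  qed
  then obtain N where N: "krylov A N b \<in> ?S N" by blast
  have inv: "A *v x \<in> ?S N" if "x \<in> ?S N" for x
  proof -
    have "A *v x \<in> (*v) A ` ?S N" using that by simp
    also have "\<dots> = span ((\<lambda>i. krylov A (Suc i) b) ` {..<N})"
      by (simp add: linear_span_image[symmetric] image_image)
    also have "\<dots> \<subseteq> ?S N"
    proof (rule span_minimal)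
      show "(\<lambda>i. krylov A (Suc i) b) ` {..<N} \<subseteq> ?S N"
      proof clarify
        fix i assume "i < N"
        then show "krylov A (Suc i) b \<in> ?S N"
          using N by (cases "Suc i = N") (auto intro: span_base simp del: funpow.simps)
      qed
    qed simp
    finally show ?thesis .
  qed
  have "krylov A k b \<in> ?S N" for k
  proof (induction k)
    case 0
    show ?case
    proof (cases "N = 0")
      case False
      then show ?thesis by (intro span_base image_eqI[of _ _ 0]) auto
    qed (use N in simp)
  qed (use inv in simp)
  then show ?thesis by blast
qed

lemma krylov_curve_zero_at_high_root:
  assumes "f = [:-d, 1:] ^ N * h" and "poly h d \<noteq> 0"
  shows "krylov_curve A b N f a d = 0"
proof -
  have "poly (krylov_coeff f a i) d = 0" if "i < N" for i
    using krylov_coeff_root[OF assms, of i a] that by auto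
  then show ?thesis by (simp add: krylov_curve_def)
qed

text \<open>
  One statement for both ends of the time interval: \<open>d\<close> is the time at which the state is \<open>0\<close> and
  \<open>c\<close> the time at which it is observed. The polynomial \<open>(X - c)\<^sup>j (X - d)\<^sup>N\<close> generates a curve that
  vanishes at \<open>d\<close> and whose leading term at \<open>c\<close> is a nonzero multiple of \<open>A\<^sup>N\<^sup>-\<^sup>1\<^sup>-\<^sup>j b\<close>, the other
  terms being lower powers. Letting \<open>j\<close> run downwards from \<open>N - 1\<close>, one obtains the powers
  below \<open>N\<close> one at a time, and the others lie in their span.
\<close>
lemma krylov_in_reaching_subspace:
  fixes A :: "real ^ 'n ^ 'n" and B :: "real ^ 'm ^ 'n" and c d :: real
  assumes V: "subspace V" and cd: "c \<noteq> d"
    and curve: "\<And>u x. trajectory_on 1 A B u x \<Longrightarrow> x d = 0 \<Longrightarrow> x c \<in> V"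
  shows "krylov A k (B *v e) \<in> V"
proof -
  let ?b = "B *v e"
  obtain N where N: "\<And>k. krylov A k ?b \<in> span ((\<lambda>i. krylov A i ?b) ` {..<N})"
    using krylov_stabilizes[of A ?b] by blast
  obtain a0 where a0: "krylov A N ?b = (\<Sum>i<N. a0 i *\<^sub>R krylov A i ?b)"
    using span_image_lessThan[OF N] by blast
  \<comment> \<open>The curve lists the powers in descending order, with index \<open>i\<close> at \<open>A\<^sup>N\<^sup>-\<^sup>1\<^sup>-\<^sup>i b\<close>.\<close>
  define a where "a i = a0 (N - Suc i)" for i
  have a: "krylov A N ?b = (\<Sum>i<N. a i *\<^sub>R krylov A (N - Suc i) ?b)"
    unfolding a0 a_def by (rule sum.nat_diff_reindex[symmetric])
  have low: "krylov A k ?b \<in> V" if "k < N" for k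
    using that
  proof (induction k rule: less_induct)
    case (less k)
    define j where "j = N - Suc k"
    have j: "j < N" "N - Suc j = k" using less.prems by (auto simp: j_def)
    define f where "f = [:-c, 1:] ^ j * [:-d, 1:] ^ N"
    let ?x = "krylov_curve A ?b N f a" and ?w = "\<lambda>i. poly (krylov_coeff f a i) c"
    have root: "\<exists>g. krylov_coeff f a i = [:-c, 1:] ^ (j - i) * g \<and> poly g c \<noteq> 0" if "i \<le> j" for i
      using cd that by (intro krylov_coeff_root[OF f_def]) auto
    have "?x d = 0"
      using cd by (intro krylov_curve_zero_at_high_root[of _ _ _ "[:-c, 1:] ^ j"])
        (auto simp: f_def mult.commute)
    then have xV: "?x c \<in> V"
      using curve trajectory_krylov_curve[OF a refl] by blast
    have "?w i = 0" if "i < j" for i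
      using root[of i] that by auto
    moreover have wj: "?w j \<noteq> 0"
      using root[of j] by auto
    ultimately have "?w i *\<^sub>R krylov A (N - Suc i) ?b \<in> V" if "i \<in> {..<N} - {j}" for i
    proof (cases "i < j")
      case True
      then show ?thesis using \<open>\<And>i. i < j \<Longrightarrow> ?w i = 0\<close> V by (simp add: subspace_0)
    next
      case False
      then have "N - Suc i < k" "N - Suc i < N" using that j by auto
      then show ?thesis using less.IH V by (simp add: subspace_scale)
    qed
    then have rest: "(\<Sum>i\<in>{..<N} - {j}. ?w i *\<^sub>R krylov A (N - Suc i) ?b) \<in> V"
      using V by (intro subspace_sum)
    have eq: "?x c = ?w j *\<^sub>R krylov A k ?b +
        (\<Sum>i\<in>{..<N} - {j}. ?w i *\<^sub>R krylov A (N - Suc i) ?b)"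
      unfolding krylov_curve_def using j by (subst sum.remove[of _ j]) auto
    have "?w j *\<^sub>R krylov A k ?b \<in> V"
      using subspace_diff[OF V xV rest] by (simp add: eq)
    then have "inverse (?w j) *\<^sub>R ?w j *\<^sub>R krylov A k ?b \<in> V"
      using V by (rule subspace_scale[rotated])
    then show ?case using wj by simp
  qed
  have "span ((\<lambda>i. krylov A i ?b) ` {..<N}) \<subseteq> V"
    using low V by (intro span_minimal) auto
  then show ?thesis using N by blast
qed

text \<open>
  The states that can be steered to \<open>0\<close>, and those that can be reached from \<open>0\<close>, are subspaces
  that contain every \<open>A\<^sup>k B e\<close>. The hypothesis says that these vectors span the state space, and
  superposing a trajectory of each kind joins any two states.
\<close>
lemma kalman_imp_controllable:
  fixes A :: "real ^ 'n ^ 'n" and B :: "real ^ 'm ^ 'n"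
  assumes kalman: "\<And>w. (\<And>k e. w \<bullet> krylov A k (B *v e) = 0) \<Longrightarrow> w = 0"
  shows "controllable A B"
proof -
  let ?K = "{krylov A k (B *v e) | k e. True}"
  have K: "span ?K = UNIV"
  proof (rule ccontr)
    assume "span ?K \<noteq> UNIV"
    then obtain w where "w \<noteq> 0" "\<forall>x\<in>span ?K. w \<bullet> x = 0"
      using span_not_UNIV_orthogonal by blast
    then show False using kalman[of w] span_base[of _ ?K] by blast
  qed
  let ?V0 = "(\<lambda>x. (x, 0)) -` reaches A B" and ?V1 = "(\<lambda>x. (0, x)) -` reaches A B"
  have V0: "subspace ?V0" and V1: "subspace ?V1"
    by (rule linear_subspace_vimage[OF _ subspace_reaches]; simp add: linear_iff)+
  have in_reaches: "(x 0, x 1) \<in> reaches A B" if "trajectory_on 1 A B u x" for u x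
    using that by (auto simp: reaches_def)
  have "krylov A k (B *v e) \<in> ?V0" for k e
  proof (rule krylov_in_reaching_subspace[OF V0, of 0 1])
    show "x 0 \<in> ?V0" if "trajectory_on 1 A B u x" "x 1 = 0" for u x
      using in_reaches[OF that(1)] that(2) by simp
  qed simp
  moreover have "krylov A k (B *v e) \<in> ?V1" for k e
  proof (rule krylov_in_reaching_subspace[OF V1, of 1 0])
    show "x 1 \<in> ?V1" if "trajectory_on 1 A B u x" "x 0 = 0" for u x
      using in_reaches[OF that(1)] that(2) by simp
  qed simp
  ultimately have "?K \<subseteq> ?V0" "?K \<subseteq> ?V1"
    by blast+
  then have "span ?K \<subseteq> ?V0" "span ?K \<subseteq> ?V1"
    by (simp_all only: span_minimal V0 V1)
  then have "(x0, 0) + (0, x1) \<in> reaches A B" for x0 x1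
    using K subspace_add[OF subspace_reaches] by blast
  then have *: "(x0, x1) \<in> reaches A B" for x0 x1
    by (metis add.right_neutral add_Pair add_0)
  show ?thesis
    unfolding controllable_def
  proof (intro allI exI[of _ "1::real"] conjI)
    fix x0 x1
    show "\<exists>u x. trajectory_on 1 A B u x \<and> x 0 = x0 \<and> x 1 = x1"
      using *[of x0 x1] by (auto simp: reaches_def)
  qed simp
qed

section \<open>Passing between a pattern and its modification\<close>

text \<open>
  A subspace is not covered by the kernels of finitely many functionals, none of which vanishes on
  it: if \<open>x\<close> is good for all functionals but the last, and the last does not vanish at \<open>y\<close>, then
  \<open>x + s y\<close> is good for all of them outside a finite set of scalars \<open>s\<close>.
\<close>
lemma subspace_generic_vector:
  fixes W :: "'a::real_vector set"
  assumes W: "subspace W" and "finite L"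
    and "\<And>\<phi>. \<phi> \<in> L \<Longrightarrow> linear (\<phi> :: 'a \<Rightarrow> real) \<and> (\<exists>y\<in>W. \<phi> y \<noteq> 0)"
  shows "\<exists>x\<in>W. \<forall>\<phi>\<in>L. \<phi> x \<noteq> 0"
  using assms(2,3)
proof (induction L rule: finite_induct)
  case empty
  then show ?case using subspace_0[OF W] by blast
next
  case (insert \<psi> L)
  then obtain x where x: "x \<in> W" "\<forall>\<phi>\<in>L. \<phi> x \<noteq> 0" by blast
  from insert.prems obtain y where y: "y \<in> W" "\<psi> y \<noteq> 0" by blast
  let ?bad = "(\<lambda>\<phi>. - \<phi> x / \<phi> y) ` insert \<psi> L"
  \<comment> \<open>Excluding \<open>0\<close> handles the new functional in case it vanishes at \<open>x\<close>; functionals that vanish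
    at \<open>y\<close> impose no condition on \<open>s\<close>.\<close>
  obtain s where s: "s \<notin> insert 0 ?bad"
    using ex_new_if_finite[OF infinite_UNIV_char_0, of "insert 0 ?bad"] insert.hyps by blast
  have "\<phi> (x + s *\<^sub>R y) \<noteq> 0" if "\<phi> \<in> insert \<psi> L" for \<phi>
  proof -
    have eq: "\<phi> (x + s *\<^sub>R y) = \<phi> x + s * \<phi> y"
      using insert.prems[OF that] by (simp add: linear_add linear_scale)
    show ?thesis
    proof (cases "\<phi> y = 0")
      case True
      then show ?thesis using that x y eq by auto
    next
      case False
      have "s \<noteq> - \<phi> x / \<phi> y" using s that by blast
      then show ?thesis using False by (simp add: eq field_simps add_eq_0_iff2)
    qed
  qed
  moreover have "x + s *\<^sub>R y \<in> W"
    using x y W by (simp add: subspace_add subspace_scale)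
  ultimately show ?case by blast
qed

text \<open>
  The first rank condition forces row multiplication by \<open>A\<close> to map the space \<open>W\<close> of obstructions
  to controllability onto itself. This makes the supports of a generic \<open>x\<close> in \<open>W\<close> and of \<open>x A\<close>
  equal, which is what makes the diagonal correction \<open>D\<close> invertible. Invertibility is needed exactly
  where the diagonal of the pattern is zero, as \<open>A - D\<close> has to be nonzero there.
\<close>
lemma pattern_bar_rank_imp_controllable:
  fixes P :: "pattern_symbol ^ 'n ^ 'n" and B :: "real ^ 'm ^ 'n"
  assumes A: "A \<in> pattern_class P"
    and r1: "\<And>x. x v* A = 0 \<Longrightarrow> x v* B = 0 \<Longrightarrow> x = 0"
    and r2: "\<And>A' x. A' \<in> pattern_class (pattern_bar P) \<Longrightarrow> x v* A' = 0 \<Longrightarrow> x v* B = 0 \<Longrightarrow> x = 0"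
  shows "controllable A B"
proof (rule kalman_imp_controllable)
  define W where "W = {w. \<forall>k e. w \<bullet> krylov A k (B *v e) = 0}"
  have sW: "subspace W"
    by (auto simp: W_def subspace_def inner_add_left)
  have WB: "w v* B = 0" if "w \<in> W" for w
  proof -
    have "(w v* B) \<bullet> e = 0" for e
      using that by (auto simp: W_def dot_lmul_matrix dest: spec[of _ 0])
    then show ?thesis using inner_eq_zero_iff by blast
  qed
  have WA: "w v* A \<in> W" if "w \<in> W" for w
  proof -
    have "w \<bullet> krylov A (Suc k) (B *v e) = 0" for k e
      using that unfolding W_def by blast
    then show ?thesis by (simp add: W_def dot_lmul_matrix)
  qed
  have lin: "linear (\<lambda>w. w v* A)"
    using matrix_vector_mul_linear[of "transpose A"] by simp
  have AW: "(\<lambda>w. w v* A) ` W = W"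
  proof (rule subspace_dim_equal)
    have "inj_on (\<lambda>w. w v* A) W"
      using r1 WB by (subst linear_inj_on_iff_eq_0[OF lin]) (auto simp: sW)
    then show "dim W \<le> dim ((\<lambda>w. w v* A) ` W)"
      using dim_image_eq[OF lin, of W] sW by (simp add: span_eq_iff[THEN iffD2])
  qed (use WA sW lin in \<open>auto intro: linear_subspace_image\<close>)
  define S where "S = {i. \<exists>w\<in>W. w $ i \<noteq> 0}"
  let ?L = "(\<lambda>i w. w $ i) ` S \<union> (\<lambda>i w. (w v* A) $ i) ` S"
  have "\<exists>x\<in>W. \<forall>\<phi>\<in>?L. \<phi> x \<noteq> 0"
  proof (rule subspace_generic_vector[OF sW])
    fix \<phi> assume "\<phi> \<in> ?L"
    then consider i where "i \<in> S" "\<phi> = (\<lambda>w. w $ i)" | i where "i \<in> S" "\<phi> = (\<lambda>w. (w v* A) $ i)"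
      by blast
    then show "linear \<phi> \<and> (\<exists>y\<in>W. \<phi> y \<noteq> 0)"
    proof cases
      case 1
      then show ?thesis by (auto simp: S_def linear_iff)
    next
      case (2 i)
      then obtain w where "w \<in> (\<lambda>w. w v* A) ` W" "w $ i \<noteq> 0" using AW by (auto simp: S_def)
      moreover have "linear \<phi>"
        using lin 2 by (auto simp: linear_iff)
      ultimately show ?thesis using 2 by auto
    qed
  qed simp
  then obtain x where x: "x \<in> W" and gen: "\<forall>\<phi>\<in>?L. \<phi> x \<noteq> 0" by (rule bexE)
  have xi: "x $ i \<noteq> 0 \<and> (x v* A) $ i \<noteq> 0" if "i \<in> S" for i
    using gen that by (simp add: ball_Un)
  \<comment> \<open>Outside \<open>S\<close> both \<open>x\<close> and \<open>x A\<close> vanish, and any nonzero entry will do.\<close>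
  define D where "D i = (if i \<in> S then (x v* A) $ i / x $ i else 1)" for i
  define A' where "A' = (\<chi> i j. A $ i $ j - (if i = j then D i else 0))"
  have D: "x $ i * D i = (x v* A) $ i" for i
    using x xi WA[OF x] by (cases "i \<in> S") (auto simp: D_def S_def)
  have "D i \<noteq> 0" for i
    using xi by (auto simp: D_def)
  then have "A' \<in> pattern_class (pattern_bar P)"
    using A by (auto simp: pattern_class_def pattern_bar_def A'_def)
  moreover have "x v* A' = 0"
  proof -
    have "(x v* A') $ j = (x v* A) $ j - x $ j * D j" for j
      by (simp add: vector_matrix_mult_def A'_def algebra_simps sum_subtractf
          if_distrib[of "\<lambda>c. c * _"] if_distrib[of "\<lambda>c. _ * c"] cong: if_cong)
    then show ?thesis using D by (simp add: vec_eq_iff)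
  qed
  ultimately have "x = 0" using r2 WB[OF x] by blast
  then have S: "S = {}" using xi by force
  fix w assume "\<And>k e. w \<bullet> krylov A k (B *v e) = 0"
  then have "w \<in> W" by (simp add: W_def)
  then show "w = 0" using S by (auto simp: S_def vec_eq_iff)
qed

text \<open>
  The matrix \<open>A\<close> is \<open>M\<close> with its columns scaled by nonzero factors, plus the identity. The scaling
  affects neither \<open>x M = 0\<close> nor the zero pattern off the diagonal, so the factors are free
  to be chosen such that the diagonal of \<open>A\<close> fits the original pattern.
\<close>
lemma pattern_bar_kernel_imp_eigenvector:
  fixes P :: "pattern_symbol ^ 'n ^ 'n"
  assumes M: "M \<in> pattern_class (pattern_bar P)" and x: "x v* M = 0"
  shows "\<exists>A \<in> pattern_class P. x v* A = x"
proof -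
  \<comment> \<open>The diagonal entry becomes \<open>M $ j $ j * c j + 1\<close>: the first choice makes it zero, and the
    other two keep it nonzero, which suits both remaining symbols.\<close>
  define c :: "'n \<Rightarrow> real" where "c j = (if P $ j $ j = PZero then - 1 / M $ j $ j else
     if M $ j $ j = - 1 then 2 else 1)" for j
  define A where "A = (\<chi> i j. M $ i $ j * c j + (if i = j then 1 else 0))"
  have diag: "P $ j $ j = PZero \<Longrightarrow> M $ j $ j \<noteq> 0" for j
    using M by (auto simp: pattern_class_def pattern_bar_def dest: spec[of _ j])
  have off: "(P $ i $ j = PZero \<longrightarrow> M $ i $ j = 0) \<and> (P $ i $ j = PStar \<longrightarrow> M $ i $ j \<noteq> 0)"
    if "i \<noteq> j" for i j
    using M that by (auto simp: pattern_class_def pattern_bar_def)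
  have c: "c j \<noteq> 0" for j
    using diag by (auto simp: c_def)
  have "A \<in> pattern_class P"
    unfolding pattern_class_def
  proof (intro CollectI allI)
    fix i j
    show "(P $ i $ j = PZero \<longrightarrow> A $ i $ j = 0) \<and> (P $ i $ j = PStar \<longrightarrow> A $ i $ j \<noteq> 0)"
    proof (cases "i = j")
      case True
      then show ?thesis using diag[of j] by (auto simp: A_def c_def add_eq_0_iff2)
    next
      case False
      then show ?thesis using off[OF False] c by (auto simp: A_def)
    qed
  qed
  moreover have "x v* A = x"
  proof -
    have "(x v* A) $ j = (x v* M) $ j * c j + x $ j" for j
      by (simp add: vector_matrix_mult_def A_def algebra_simps sum.distrib sum_distrib_left
          if_distrib[of "\<lambda>c. c * _"] if_distrib[of "\<lambda>c. _ * c"] cong: if_cong)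
    then show ?thesis using x by (simp add: vec_eq_iff)
  qed
  ultimately show ?thesis by blast
qed

theorem theorem7:
  fixes \<A> :: "pattern_symbol ^ 'n ^ 'n" and \<B> :: "pattern_symbol ^ 'm ^ 'n"
  shows "strongly_structurally_controllable \<A> \<B> \<longleftrightarrow>
    pattern_full_row_rank (hconcat \<A> \<B>) \<and>
    pattern_full_row_rank (hconcat (pattern_bar \<A>) \<B>)"
proof (intro iffI conjI)
  assume C: "strongly_structurally_controllable \<A> \<B>"
  have no_ev: "x = 0" if "A \<in> pattern_class \<A>" "B \<in> pattern_class \<B>"
    "x v* A = l *\<^sub>R x" "x v* B = 0" for A B x l
    using C that controllable_imp_no_left_eigenvector
    unfolding strongly_structurally_controllable_def by blast
  show "pattern_full_row_rank (hconcat \<A> \<B>)"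
    unfolding pattern_full_row_rank_hconcat_iff
    using no_ev[where l = 0] by auto
  show "pattern_full_row_rank (hconcat (pattern_bar \<A>) \<B>)"
    unfolding pattern_full_row_rank_hconcat_iff
    using no_ev[where l = 1] pattern_bar_kernel_imp_eigenvector by fastforce
next
  assume "pattern_full_row_rank (hconcat \<A> \<B>) \<and>
    pattern_full_row_rank (hconcat (pattern_bar \<A>) \<B>)"
  then show "strongly_structurally_controllable \<A> \<B>"
    unfolding pattern_full_row_rank_hconcat_iff strongly_structurally_controllable_def
    by (blast intro: pattern_bar_rank_imp_controllable)
qed

end
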